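(* For every word $w$ over a finite alphabet and every set $P$ of positions on $w$, $P$ is a word attractor of $w$ if and only if the algorithm $\mathrm{IsAttractor}(w,P)$ returns $\mathrm{True}$.
   Context: Let $w=w_1w_2\cdots w_n$ be a finite word over a finite alphabet, $|w|=n$. Positions on $w$ are the elements of $\{1,\dots,n\}$, and a set of positions is a subset $P\subseteq\{1,\dots,n\}$. A factor of $w$ is a word $w_{[i,j]}=w_i\cdots w_j$ (the empty word if $j<i$). An occurrence of a non-empty factor $u$ in $w$ is a pair $(i,j)$, $1\le i\le j\le n$, with $u=w_{[i,j]}$; $j$ is its ending position. A non-empty factor $u$ covers $P$ if there is an occurrence $(i,j)$ of $u$ in $w$ and $t\in P$ with $i\le t\le j$. $P$ is a word attractor of $w$ if every non-empty factor of $w$ covers $P$. Suffix automaton (DAWG): the states of $\mathcal{S}(w)$ are the equivalence classes of the factors of $w$ (including the empty word), where two factors are equivalent iff they have the same set of ending positions in $w$ (the empty word having ending positions $0,1,\dots,n$). The initial state $I$ is the class of the empty word. For a factor $u$, $\delta(I,u)$ is the class of $u$. For a state $q$, $\ell[q]$ is the minimum length of the factors in $q$. Suffix links: for a state $q\neq I$ and any factor $x\in q$, $F[q]$ is the class of the longest suffix of $x$ that does not belong to $q$ (independent of the choice of $x$). The map $F$, viewed as a parent map, makes the set of states a tree $\mathcal{T}$ rooted at $I$. The table of prefix states is $T[j]=\delta(I,w_{[1,j]})$ for $1\le j\le n$. Algorithm $\mathrm{IsAttractor}(w,P)$: 1. For each state $q$ of $\mathcal{S}(w)$ set $d[q]\leftarrow+\infty$.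 2. Set $k\leftarrow-\infty$. For $j=1,2,\dots,|w|$ in this order: if $j\in P$ then set $k\leftarrow j$; then set $d[T[j]]\leftarrow j-k$ (which is $+\infty$ if $k=-\infty$). 3. For each node $q\neq I$ in a bottom-up traversal of $\mathcal{T}$ (children before parents): set $d[q]\leftarrow\min(\{d[q]\}\cup\{d[r]\mid F[r]=q\})$; if $d[q]\ge\ell[q]$, return $\mathrm{False}$ (and stop). 4. Return $\mathrm{True}$. *)

theory Defs
  imports "HOL-Library.Sublist" "HOL-Library.Extended_Real"
begin

text \<open>Positions are counted from 1, so \<open>slice w i j\<close> is \<open>w\<^sub>i \<dots> w\<^sub>j\<close> for \<open>1 \<le> i\<close>, and it is
  empty for \<open>j < i\<close>.\<close>

definition slice :: "'a list \<Rightarrow> nat \<Rightarrow> nat \<Rightarrow> 'a list" where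
  "slice w i j = drop (i - 1) (take j w)"

definition factors :: "'a list \<Rightarrow> 'a list set" where
  "factors w = {slice w i j | i j. 1 \<le> i \<and> j \<le> length w}"

definition occurrence :: "'a list \<Rightarrow> 'a list \<Rightarrow> nat \<Rightarrow> nat \<Rightarrow> bool" where
  "occurrence w u i j \<longleftrightarrow> 1 \<le> i \<and> i \<le> j \<and> j \<le> length w \<and> u = slice w i j"

definition covers :: "'a list \<Rightarrow> nat set \<Rightarrow> 'a list \<Rightarrow> bool" where
  "covers w P u \<longleftrightarrow> (\<exists>i j t. occurrence w u i j \<and> t \<in> P \<and> i \<le> t \<and> t \<le> j)"

definition word_attractor :: "'a list \<Rightarrow> nat set \<Rightarrow> bool" where
  "word_attractor w P \<longleftrightarrow> (\<forall>u\<in>factors w. u \<noteq> [] \<longrightarrow> covers w P u)"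

definition end_positions :: "'a list \<Rightarrow> 'a list \<Rightarrow> nat set" where
  "end_positions w u =
     (if u = [] then {0..length w} else {j. \<exists>i. occurrence w u i j})"

definition end_equiv :: "'a list \<Rightarrow> ('a list \<times> 'a list) set" where
  "end_equiv w =
     {(u, v). u \<in> factors w \<and> v \<in> factors w \<and> end_positions w u = end_positions w v}"

definition states :: "'a list \<Rightarrow> 'a list set set" where
  "states w = factors w // end_equiv w"

text \<open>\<open>state_of w u\<close> is \<open>\<delta>(I, u)\<close>, for a factor \<open>u\<close> of \<open>w\<close>.\<close>

definition state_of :: "'a list \<Rightarrow> 'a list \<Rightarrow> 'a list set" where
  "state_of w u = end_equiv w `` {u}"

definition initial_state :: "'a list \<Rightarrow> 'a list set" where
  "initial_state w = state_of w []"

definition min_len :: "'a list set \<Rightarrow> nat" where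
  "min_len q = Min (length ` q)"

definition longest_suffix_outside :: "'a list set \<Rightarrow> 'a list \<Rightarrow> 'a list" where
  "longest_suffix_outside q x = (ARG_MAX length s. suffix s x \<and> s \<notin> q)"

text \<open>Meaningful only for states other than the initial one, which contains every suffix of its
  only element. That the choice of \<open>x\<close> is immaterial is \<open>suffix_link_eq\<close> below.\<close>

definition suffix_link :: "'a list \<Rightarrow> 'a list set \<Rightarrow> 'a list set" where
  "suffix_link w q = state_of w (longest_suffix_outside q (SOME x. x \<in> q))"

definition prefix_state :: "'a list \<Rightarrow> nat \<Rightarrow> 'a list set" where
  "prefix_state w j = state_of w (slice w 1 j)"

definition children :: "'a list \<Rightarrow> 'a list set \<Rightarrow> 'a list set set" where
  "children w q = {r \<in> states w - {initial_state w}. suffix_link w r = q}"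

definition bottom_up_traversal :: "'a list \<Rightarrow> 'a list set list \<Rightarrow> bool" where
  "bottom_up_traversal w qs \<longleftrightarrow>
     distinct qs \<and> set qs = states w - {initial_state w} \<and>
     (\<forall>i<length qs. \<forall>j<length qs. suffix_link w (qs ! i) = qs ! j \<longrightarrow> i < j)"

text \<open>The pair is \<open>(k, d)\<close>. For \<open>k = -\<infinity>\<close> the difference below is \<open>\<infinity>\<close>.\<close>

definition position_step ::
  "'a list \<Rightarrow> nat set \<Rightarrow> nat \<Rightarrow> ereal \<times> ('a list set \<Rightarrow> ereal) \<Rightarrow>
    ereal \<times> ('a list set \<Rightarrow> ereal)" where
  "position_step w P j = (\<lambda>(k, d).
     let k' = (if j \<in> P then ereal (real j) else k)
     in (k', d(prefix_state w j := ereal (real j) - k')))"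

definition initial_distances :: "'a list \<Rightarrow> nat set \<Rightarrow> 'a list set \<Rightarrow> ereal" where
  "initial_distances w P =
     snd (fold (position_step w P) [1..<length w + 1] (-\<infinity>, \<lambda>q. \<infinity>))"

fun traverse :: "'a list \<Rightarrow> 'a list set list \<Rightarrow> ('a list set \<Rightarrow> ereal) \<Rightarrow> bool" where
  "traverse w [] d = True"
| "traverse w (q # qs) d =
     (let d' = d(q := Min ({d q} \<union> d ` children w q))
      in if d' q \<ge> ereal (real (min_len q)) then False else traverse w qs d')"

text \<open>The traversal order \<open>qs\<close>, which the algorithm leaves open, is a parameter.\<close>

definition is_attractor_alg :: "'a list \<Rightarrow> nat set \<Rightarrow> 'a list set list \<Rightarrow> bool" where
  "is_attractor_alg w P qs = traverse w qs (initial_distances w P)"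


subsection \<open>Well-definedness\<close>

lemma factors_iff: "u \<in> factors w \<longleftrightarrow> sublist u w"
proof
  assume "u \<in> factors w"
  then show "sublist u w"
    unfolding factors_def slice_def
    using sublist_drop sublist_take by (auto intro: sublist_order.order_trans)
next
  assume "sublist u w"
  then obtain ps ss where w: "w = ps @ u @ ss" by (auto simp: sublist_def)
  have "u = slice w (Suc (length ps)) (length ps + length u)"
    by (simp add: w slice_def)
  moreover have "length ps + length u \<le> length w" by (simp add: w)
  ultimately show "u \<in> factors w" unfolding factors_def by fastforce
qed

lemma finite_factors: "finite (factors w)"
  by (rule finite_subset[of _ "set (sublists w)"]) (auto simp: factors_iff)

lemma equiv_end_equiv: "equiv (factors w) (end_equiv w)"
  by (auto simp: end_equiv_def equiv_def refl_on_def sym_def trans_def)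

lemma in_end_positions:
  "j \<in> end_positions w u \<longleftrightarrow> j \<le> length w \<and> suffix u (take j w)"
proof (cases "u = []")
  case False
  have "(\<exists>i. occurrence w u i j) \<longleftrightarrow> j \<le> length w \<and> suffix u (take j w)"
  proof safe
    fix i assume "occurrence w u i j"
    then show "j \<le> length w" "suffix u (take j w)"
      by (auto simp: occurrence_def slice_def suffix_drop)
  next
    assume j: "j \<le> length w" and "suffix u (take j w)"
    then obtain ps where ps: "take j w = ps @ u" by (auto simp: suffix_def)
    then have "length ps + length u = j" using j
      by (metis length_append length_take min.absorb2)
    moreover from False have "Suc 0 \<le> length u" by (cases u) auto
    ultimately have "occurrence w u (Suc (length ps)) j"
      using j ps by (auto simp: occurrence_def slice_def)
    then show "\<exists>i. occurrence w u i j" ..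
  qed
  then show ?thesis using False by (simp add: end_positions_def)
qed (simp add: end_positions_def)

lemma end_positions_antimono: "suffix s u \<Longrightarrow> end_positions w u \<subseteq> end_positions w s"
  by (meson in_end_positions subsetI suffix_order.trans)

lemma factor_imp_end_position: "u \<in> factors w \<Longrightarrow> \<exists>j. j \<in> end_positions w u"
proof -
  assume "u \<in> factors w"
  then obtain ps ss where "w = ps @ u @ ss" by (auto simp: factors_iff sublist_def)
  then have "length (ps @ u) \<in> end_positions w u"
    by (simp add: in_end_positions suffix_def)
  then show ?thesis by blast
qed

lemma state_eq:
  assumes "q \<in> states w" "x \<in> q"
  shows "x \<in> factors w" "q = {v \<in> factors w. end_positions w v = end_positions w x}"
  using assms by (auto simp: states_def quotient_def end_equiv_def)

lemma state_of_in_states: "u \<in> factors w \<Longrightarrow> state_of w u \<in> states w"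
  by (simp add: state_of_def states_def quotientI)

lemma nil_in_factors: "[] \<in> factors w"
  by (simp add: factors_iff)

lemma non_initial_state:
  assumes "q \<in> states w - {initial_state w}"
  shows "q \<noteq> {}" "[] \<notin> q"
proof -
  show "q \<noteq> {}"
    using assms in_quotient_imp_non_empty[OF equiv_end_equiv] by (auto simp: states_def)
  show "[] \<notin> q"
  proof
    assume "[] \<in> q"
    then have "q = initial_state w"
      using assms state_eq(2)[of q w "[]"] nil_in_factors
      by (auto simp: initial_state_def state_of_def end_equiv_def)
    then show False using assms by simp
  qed
qed

lemma longest_suffix_outside:
  assumes "[] \<notin> q"
  shows "suffix (longest_suffix_outside q x) x" "longest_suffix_outside q x \<notin> q"
    and "\<And>s. suffix s x \<Longrightarrow> s \<notin> q \<Longrightarrow> length s \<le> length (longest_suffix_outside q x)"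
proof -
  let ?Q = "\<lambda>s. suffix s x \<and> s \<notin> q"
  have 0: "?Q []" using assms by simp
  have b: "\<And>y. ?Q y \<Longrightarrow> length y < Suc (length x)"
    by (auto dest: suffix_length_le)
  show "suffix (longest_suffix_outside q x) x" "longest_suffix_outside q x \<notin> q"
    using arg_max_natI[of ?Q "[]" length, OF 0] b
    unfolding longest_suffix_outside_def by blast+
  fix s assume "suffix s x" "s \<notin> q"
  then show "length s \<le> length (longest_suffix_outside q x)"
    using arg_max_nat_le[of ?Q s length "Suc (length x)"] b
    unfolding longest_suffix_outside_def by blast
qed

lemma longest_suffix_outside_le:
  assumes q: "q \<in> states w - {initial_state w}" and x: "x \<in> q" and y: "y \<in> q"
    and xy: "length x \<le> length y"
  shows "longest_suffix_outside q x = longest_suffix_outside q y"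
proof -
  note out = longest_suffix_outside[OF non_initial_state(2)[OF q]]
  have ep: "end_positions w y = end_positions w x"
    and fx: "x \<in> factors w" "y \<in> factors w"
    using state_eq[of q w x] state_eq[of q w y] q x y by auto
  obtain j where "j \<in> end_positions w x" using factor_imp_end_position fx by blast
  then have "suffix x (take j w)" "suffix y (take j w)"
    using ep by (auto simp: in_end_positions)
  then have sxy: "suffix x y" using xy by (rule suffix_length_suffix)
  let ?s = "longest_suffix_outside q x" and ?t = "longest_suffix_outside q y"
  have tx: "suffix ?t x"
  proof (rule ccontr)
    assume n: "\<not> suffix ?t x"
    then have "suffix x ?t"
      using sxy out(1)[of y] suffix_same_cases by blast
    then have "end_positions w ?t = end_positions w x"
      using end_positions_antimono[of x ?t w] end_positions_antimono[OF out(1)[of y], of w] ep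
      by blast
    moreover have "?t \<in> factors w"
      using fx(2) out(1)[of y] by (meson factors_iff suffix_imp_sublist sublist_order.order_trans)
    ultimately have "?t \<in> q" using state_eq(2)[of q w x] q x by blast
    then show False using out(2)[of y] by simp
  qed
  have "length ?t \<le> length ?s" using out(3)[OF tx out(2)] .
  moreover have "length ?s \<le> length ?t"
    using out(3)[OF suffix_order.trans[OF out(1)[of x] sxy] out(2)] .
  ultimately have "length ?s = length ?t" by simp
  then show ?thesis
    using out(1)[of x] tx by (metis suffix_length_suffix order_refl suffix_order.antisym)
qed

lemma suffix_link_eq:
  assumes "q \<in> states w - {initial_state w}" and "x \<in> q"
  shows "suffix_link w q = state_of w (longest_suffix_outside q x)"
proof -
  have "(SOME x. x \<in> q) \<in> q" using assms(2) by (rule someI)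
  then have "longest_suffix_outside q (SOME x. x \<in> q) = longest_suffix_outside q x"
    using longest_suffix_outside_le[OF assms(1)] assms(2) by (metis nat_le_linear)
  then show ?thesis by (simp add: suffix_link_def)
qed

definition state_ends :: "'a list \<Rightarrow> 'a list set \<Rightarrow> nat set" where
  "state_ends w q = \<Union> (end_positions w ` q)"

lemma state_ends_suffix_link:
  assumes q: "q \<in> states w - {initial_state w}"
  shows "suffix_link w q \<in> states w" "state_ends w q \<subset> state_ends w (suffix_link w q)"
proof -
  note out = longest_suffix_outside[OF non_initial_state(2)[OF q]]
  obtain x where x: "x \<in> q" using non_initial_state(1)[OF q] by blast
  let ?s = "longest_suffix_outside q x"
  note qx = state_eq[OF _ x, of w]
  have fs: "?s \<in> factors w"
    using qx(1) q out(1)[of x] by (meson DiffD1 factors_iff suffix_imp_sublist sublist_order.order_trans)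
  have Fq: "suffix_link w q = {v \<in> factors w. end_positions w v = end_positions w ?s}"
    using suffix_link_eq[OF q x] fs by (auto simp: state_of_def end_equiv_def)
  show "suffix_link w q \<in> states w"
    using suffix_link_eq[OF q x] state_of_in_states[OF fs] by simp
  have 1: "state_ends w q = end_positions w x"
    using qx x q unfolding state_ends_def by blast
  have 2: "state_ends w (suffix_link w q) = end_positions w ?s"
    using Fq fs unfolding state_ends_def by blast
  have "end_positions w ?s \<noteq> end_positions w x"
    using qx q fs out(2)[of x] by blast
  then show "state_ends w q \<subset> state_ends w (suffix_link w q)"
    unfolding 1 2 using end_positions_antimono[OF out(1)[of x], of w] by blast
qed

lemma finite_states: "finite (states w)"
proof -
  have "states w \<subseteq> Pow (factors w)"
    by (auto simp: states_def quotient_def end_equiv_def)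
  then show ?thesis
    using finite_factors[of w] by (meson finite_Pow_iff finite_subset)
qed

lemma bottom_up_traversal_exists: "\<exists>qs. bottom_up_traversal w qs"
proof -
  let ?S = "states w - {initial_state w}" and ?f = "\<lambda>q. card (state_ends w q)"
  obtain xs where xs: "set xs = ?S" "distinct xs"
    using finite_distinct_list finite_states by (metis finite_Diff)
  define qs where "qs = sort_key ?f xs"
  have fin: "finite (state_ends w r)" for r
    by (rule finite_subset[of _ "{..length w}"]) (auto simp: state_ends_def in_end_positions)
  have qs: "set qs = ?S" "distinct qs" using xs by (simp_all add: qs_def)
  have "i < j" if "i < length qs" "j < length qs" "suffix_link w (qs ! i) = qs ! j" for i j
  proof (rule ccontr)
    assume "\<not> i < j"
    then have "map ?f qs ! j \<le> map ?f qs ! i"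
      using that by (intro sorted_nth_mono) (auto simp: qs_def)
    moreover have "qs ! i \<in> ?S" using that(1) by (simp flip: qs(1))
    then have "?f (qs ! i) < ?f (qs ! j)"
      using psubset_card_mono[OF fin state_ends_suffix_link(2), of "qs ! i"] that(3) by simp
    ultimately show False using that by simp
  qed
  then have "bottom_up_traversal w qs" using qs by (simp add: bottom_up_traversal_def)
  then show ?thesis ..
qed

end

theory Submission
  imports Defs
begin

text \<open>The distance of \<open>j\<close> to the closest position of \<open>P\<close> at or before \<open>j\<close> is less than \<open>|u|\<close> iff an
  occurrence of \<open>u\<close> ending at \<open>j\<close> meets \<open>P\<close>. Hence \<open>u\<close> covers \<open>P\<close> iff the minimum of these distances
  over the ending positions of \<open>u\<close> is less than \<open>|u|\<close>, and among the words of a state the shortest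
  one is the most demanding. The traversal computes this minimum for each state, since the ending
  positions of a state are those of its children together with the \<open>j\<close> for which it is the state of
  the prefix of length \<open>j\<close>.\<close>

section \<open>Distances to the set of positions\<close>

text \<open>The value of \<open>k\<close> once position \<open>j\<close> has been handled. As a
  supremum in \<open>ereal\<close> it is -\<infinity> when no position qualifies, which is how
  \<open>k\<close> starts.\<close>

definition last_position :: "nat set \<Rightarrow> nat \<Rightarrow> ereal" where
  "last_position P j = (SUP t\<in>{t \<in> P. t \<le> j}. ereal (real t))"

definition distance :: "nat set \<Rightarrow> nat \<Rightarrow> ereal" where
  "distance P j = ereal (real j) - last_position P j"

text \<open>The value \<open>d\<close> should hold at \<open>q\<close> after the visit of
  \<open>q\<close>, given directly by the ending positions instead of recursively along the
  tree.\<close>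

definition state_distance :: "'a list \<Rightarrow> nat set \<Rightarrow> 'a list set \<Rightarrow> ereal" where
  "state_distance w P q = (INF j\<in>state_ends w q. distance P j)"

lemma last_position_0:
  assumes "0 \<notin> P"
  shows "last_position P 0 = -\<infinity>"
proof -
  have "{t \<in> P. t \<le> 0} = {}" using assms by auto
  then show ?thesis by (simp only: last_position_def image_empty Sup_empty bot_ereal_def)
qed

lemma last_position_member: "j \<in> P \<Longrightarrow> last_position P j = ereal (real j)"
  unfolding last_position_def
  by (intro antisym SUP_least SUP_upper) auto

lemma last_position_Suc_not_member:
  "Suc j \<notin> P \<Longrightarrow> last_position P (Suc j) = last_position P j"
  unfolding last_position_def by (metis le_Suc_eq)

text \<open>A supremum exceeds a bound iff some member does, so the closest position need not be
  singled out. The strict bound says that \<open>t\<close> is among the last \<open>m\<close>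
  positions up to \<open>j\<close>.\<close>

lemma distance_less_iff:
  "distance P j < ereal (real m) \<longleftrightarrow> (\<exists>t\<in>P. t \<le> j \<and> j < t + m)"
proof -
  have "distance P j < ereal (real m) \<longleftrightarrow> ereal (real j - real m) < last_position P j"
    unfolding distance_def by (cases "last_position P j") auto
  also have "\<dots> \<longleftrightarrow> (\<exists>t\<in>P. t \<le> j \<and> j < t + m)"
    unfolding last_position_def less_SUP_iff by auto
  finally show ?thesis .
qed

section \<open>States and their ending positions\<close>

lemma state_eq_state_of:
  assumes "q \<in> states w" "x \<in> q"
  shows "q = state_of w x"
  using state_eq[OF assms] by (auto simp: state_of_def end_equiv_def)

lemma state_of_eq_iff:
  assumes "u \<in> factors w" "v \<in> factors w"
  shows "state_of w u = state_of w v \<longleftrightarrow> end_positions w u = end_positions w v"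
  using assms by (auto simp: state_of_def end_equiv_def)

lemma in_state_of: "u \<in> factors w \<Longrightarrow> u \<in> state_of w u"
  by (simp add: state_of_def end_equiv_def)

lemma state_ends_eq:
  assumes "q \<in> states w" "x \<in> q"
  shows "state_ends w q = end_positions w x"
  using state_eq[OF assms] assms(2) unfolding state_ends_def by blast

lemma state_ends_state_of: "u \<in> factors w \<Longrightarrow> state_ends w (state_of w u) = end_positions w u"
  by (simp add: state_ends_eq state_of_in_states in_state_of)

lemma take_in_factors: "take j w \<in> factors w"
  by (simp add: factors_iff sublist_take)

lemma suffix_in_factors: "suffix s u \<Longrightarrow> u \<in> factors w \<Longrightarrow> s \<in> factors w"
  by (meson factors_iff suffix_imp_sublist sublist_order.order_trans)

lemma prefix_state_eq: "prefix_state w j = state_of w (take j w)"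
  by (simp add: prefix_state_def slice_def)

lemma zero_end_position_iff: "0 \<in> end_positions w u \<longleftrightarrow> u = []"
  by (simp add: in_end_positions)

text \<open>Position 0 is an ending position of the empty word only.\<close>

lemma state_of_noninitial:
  assumes "u \<in> factors w" "u \<noteq> []"
  shows "state_of w u \<in> states w - {initial_state w}"
proof -
  have "end_positions w u \<noteq> end_positions w []"
    using assms(2) zero_end_position_iff by blast
  then show ?thesis
    using assms(1) by (simp add: state_of_in_states initial_state_def state_of_eq_iff nil_in_factors)
qed

section \<open>The loop over positions\<close>

text \<open>Prefixes with the same ending positions are suffixes of each other. Hence the loop never
  writes to a state twice.\<close>

lemma inj_on_prefix_state: "inj_on (prefix_state w) {..length w}"
proof (rule inj_onI)
  fix i j assume ij: "i \<in> {..length w}" "j \<in> {..length w}" "prefix_state w i = prefix_state w j"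
  then have "end_positions w (take i w) = end_positions w (take j w)"
    by (simp add: prefix_state_eq state_of_eq_iff take_in_factors)
  moreover have "i \<in> end_positions w (take i w)" "j \<in> end_positions w (take j w)"
    using ij by (simp_all add: in_end_positions)
  ultimately have "j \<in> end_positions w (take i w)" "i \<in> end_positions w (take j w)"
    by simp_all
  then have "suffix (take j w) (take i w)" "suffix (take i w) (take j w)"
    by (simp_all add: in_end_positions)
  then show "i = j" using ij by (auto dest!: suffix_length_le)
qed

text \<open>Loop invariant. Each infimum ranges over at most one position, and over none it is the
  default \<infinity>. With \<open>0 \<notin> P\<close> the starting value of \<open>k\<close> is
  \<open>last_position P 0\<close>.\<close>

lemma fold_position_step:
  assumes "0 \<notin> P" "m \<le> length w"
  shows "fold (position_step w P) [1..<m + 1] (-\<infinity>, \<lambda>q. \<infinity>) =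
    (last_position P m, \<lambda>q. INF j\<in>{j \<in> {1..m}. prefix_state w j = q}. distance P j)"
  using assms(2)
proof (induction m)
  case 0
  then show ?case using assms(1) by (simp add: last_position_0 top_ereal_def)
next
  case (Suc m)
  have k: "(if Suc m \<in> P then ereal (real (Suc m)) else last_position P m) = last_position P (Suc m)"
    by (simp add: last_position_member last_position_Suc_not_member)
  \<comment> \<open>By injectivity no earlier position shares this prefix state, so overwriting its
    entry loses nothing.\<close>
  have "{j \<in> {1..Suc m}. prefix_state w j = q} =
      (if q = prefix_state w (Suc m) then {Suc m} else {j \<in> {1..m}. prefix_state w j = q})" for q
    using inj_onD[OF inj_on_prefix_state, of w _ "Suc m"] Suc.prems
    by (auto simp: le_Suc_eq)
  then have d: "(\<lambda>q. INF j\<in>{j \<in> {1..m}. prefix_state w j = q}. distance P j)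
        (prefix_state w (Suc m) := distance P (Suc m)) =
      (\<lambda>q. INF j\<in>{j \<in> {1..Suc m}. prefix_state w j = q}. distance P j)"
    by (auto simp: fun_eq_iff)
  have "fold (position_step w P) [1..<Suc m + 1] (-\<infinity>, \<lambda>q. \<infinity>) =
    position_step w P (Suc m) (fold (position_step w P) [1..<m + 1] (-\<infinity>, \<lambda>q. \<infinity>))"
    by simp
  also have "\<dots> = position_step w P (Suc m) (last_position P m,
      \<lambda>q. INF j\<in>{j \<in> {1..m}. prefix_state w j = q}. distance P j)"
    using Suc by (simp only: Suc_leD)
  also have "\<dots> = (last_position P (Suc m),
      \<lambda>q. INF j\<in>{j \<in> {1..Suc m}. prefix_state w j = q}. distance P j)"
    unfolding position_step_def prod.case Let_def k distance_def[symmetric] d ..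
  finally show ?case .
qed

lemma initial_distances_eq:
  assumes "0 \<notin> P"
  shows "initial_distances w P q =
    (INF j\<in>{j \<in> {1..length w}. prefix_state w j = q}. distance P j)"
  unfolding initial_distances_def fold_position_step[OF assms order_refl] by simp

section \<open>Ending positions along the tree of suffix links\<close>

text \<open>The child is the state of the suffix of \<open>w\<^sub>1 \<dots> w\<^sub>j\<close> that is one letter longer than the longest
  such suffix in \<open>q\<close>.\<close>

lemma child_containing_end_position:
  assumes q: "q \<in> states w" and j: "j \<in> state_ends w q" and ne: "prefix_state w j \<noteq> q"
  shows "\<exists>r\<in>children w q. j \<in> state_ends w r"
proof -
  let ?p = "take j w" and ?Q = "\<lambda>s. suffix s (take j w) \<and> s \<in> q"
  obtain x where x: "x \<in> q" "j \<in> end_positions w x"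
    using j by (auto simp: state_ends_def)
  have "?Q x" using x by (simp add: in_end_positions)
  moreover have "\<forall>s. ?Q s \<longrightarrow> length s < Suc (length ?p)"
    using suffix_length_le le_imp_less_Suc by blast
  ultimately obtain y where y: "?Q y" and ymax: "\<And>s. ?Q s \<Longrightarrow> length s \<le> length y"
    using Lattices_Big.ex_has_greatest_nat[of ?Q x length "Suc (length ?p)"] by auto
  have "?p \<notin> q"
    using state_eq_state_of[OF q] ne by (auto simp: prefix_state_eq)
  with y obtain zs where zs: "?p = zs @ y" "zs \<noteq> []"
    by (metis append_Nil suffixE)
  define s where "s = last zs # y"
  have s: "suffix s ?p"
    using zs unfolding s_def suffix_def
    by (metis append_butlast_last_id append_Cons append_Nil append_assoc)
  have fs: "s \<in> factors w" using suffix_in_factors[OF s take_in_factors] .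
  have "s \<notin> q" using ymax[of s] s by (auto simp: s_def)
  have r: "state_of w s \<in> states w - {initial_state w}"
    using fs by (rule state_of_noninitial) (simp add: s_def)
  have yr: "y \<notin> state_of w s"
  proof
    assume "y \<in> state_of w s"
    then have "state_of w s = q"
      using r y state_eq_state_of q by (metis DiffD1)
    then show False using in_state_of[OF fs] \<open>s \<notin> q\<close> by simp
  qed
  note out = longest_suffix_outside[OF non_initial_state(2)[OF r], where x = s]
  let ?l = "longest_suffix_outside (state_of w s) s"
  \<comment> \<open>Every proper suffix of \<open>s\<close> is a suffix of \<open>y\<close>, and
    \<open>y\<close> is outside the state of \<open>s\<close>; so \<open>y\<close> is the longest
    suffix outside, and the link leads to \<open>q\<close>.\<close>
  have "?l \<noteq> s" using out(2) in_state_of[OF fs] by auto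
  then have "suffix ?l y" using out(1) by (auto simp: s_def suffix_Cons)
  moreover have "length y \<le> length ?l"
    using out(3)[OF _ yr] by (simp add: s_def suffix_Cons)
  ultimately have "?l = y"
    by (auto simp: suffix_def)
  then have "suffix_link w (state_of w s) = q"
    using suffix_link_eq[OF r in_state_of[OF fs]] state_eq_state_of[OF q] y by simp
  moreover have "j \<in> state_ends w (state_of w s)"
    using s x by (simp add: state_ends_state_of[OF fs] in_end_positions)
  ultimately show ?thesis using r by (auto simp: children_def)
qed

lemma zero_notin_state_ends:
  assumes q: "q \<in> states w - {initial_state w}"
  shows "0 \<notin> state_ends w q"
  using non_initial_state(2)[OF q] by (auto simp: state_ends_def zero_end_position_iff)

text \<open>Where \<open>q\<close> is not the state of the prefix ending at \<open>j\<close>, a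
  longer suffix of that prefix yields a child; conversely, a link keeps all ending positions.
  Excluding the initial state rules out \<open>j = 0\<close>, which the loop does not visit.\<close>

lemma state_ends_decompose:
  assumes q: "q \<in> states w - {initial_state w}"
  shows "state_ends w q =
    {j \<in> {1..length w}. prefix_state w j = q} \<union> (\<Union>r\<in>children w q. state_ends w r)"
proof (intro subset_antisym subsetI)
  fix j assume j: "j \<in> state_ends w q"
  then have "j \<noteq> 0" using zero_notin_state_ends[OF q] by metis
  moreover have "j \<le> length w" using j by (auto simp: state_ends_def in_end_positions)
  ultimately show "j \<in> {j \<in> {1..length w}. prefix_state w j = q} \<union>
      (\<Union>r\<in>children w q. state_ends w r)"
    using child_containing_end_position[of q w j] q j by auto
next
  fix j assume "j \<in> {j \<in> {1..length w}. prefix_state w j = q} \<union>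
      (\<Union>r\<in>children w q. state_ends w r)"
  then consider "j \<le> length w" "prefix_state w j = q"
    | r where "r \<in> children w q" "j \<in> state_ends w r" by auto
  then show "j \<in> state_ends w q"
  proof cases
    case 1
    then show ?thesis
      by (auto simp: prefix_state_eq state_ends_state_of take_in_factors in_end_positions)
  next
    case 2
    then show ?thesis using state_ends_suffix_link(2) by (fastforce simp: children_def)
  qed
qed

lemma finite_children: "finite (children w q)"
  by (simp add: children_def finite_states)

lemma INF_UN:
  fixes f :: "'b \<Rightarrow> 'c :: complete_lattice"
  shows "(INF x\<in>(\<Union>y\<in>A. g y). f x) = (INF y\<in>A. INF x\<in>g y. f x)"
  by (rule order_antisym) (blast intro: INF_greatest INF_lower2)+

text \<open>The infimum splits along the decomposition of the ending positions; as the children are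
  finite in number, it is the minimum formed by the traversal.\<close>

lemma state_distance_rec:
  assumes q: "q \<in> states w - {initial_state w}" and "0 \<notin> P"
  shows "state_distance w P q =
    Min ({initial_distances w P q} \<union> state_distance w P ` children w q)"
proof -
  have "Min ({initial_distances w P q} \<union> state_distance w P ` children w q) =
      inf (initial_distances w P q) (INF r\<in>children w q. state_distance w P r)"
    by (simp add: Min_Inf finite_children)
  also have "\<dots> = state_distance w P q"
    unfolding state_distance_def state_ends_decompose[OF q] initial_distances_eq[OF assms(2)]
    by (simp add: INF_union INF_UN)
  finally show ?thesis ..
qed

section \<open>The traversal\<close>

text \<open>Invariant: \<open>d\<close> is final on the visited states \<open>ps\<close> and still
  initial on the pending states \<open>qs\<close>.\<close>

lemma traverse_iff:
  assumes P: "0 \<notin> P" and b: "bottom_up_traversal w (ps @ qs)"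
    and processed: "\<And>q. q \<in> set ps \<Longrightarrow> d q = state_distance w P q"
    and pending: "\<And>q. q \<in> set qs \<Longrightarrow> d q = initial_distances w P q"
  shows "traverse w qs d \<longleftrightarrow> (\<forall>q\<in>set qs. state_distance w P q < ereal (real (min_len q)))"
  using b processed pending
proof (induction qs arbitrary: ps d)
  case Nil
  then show ?case by simp
next
  case (Cons q qs)
  let ?all = "ps @ q # qs"
  have S: "set ?all = states w - {initial_state w}" and dist: "distinct ?all"
    and order: "\<And>i j. i < length ?all \<Longrightarrow> j < length ?all \<Longrightarrow>
      suffix_link w (?all ! i) = ?all ! j \<Longrightarrow> i < j"
    using Cons.prems(1) unfolding bottom_up_traversal_def by blast+
  have q: "q \<in> states w - {initial_state w}" using S by auto
  have ch: "children w q \<subseteq> set ps"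
  proof
    fix r assume "r \<in> children w q"
    then have r: "r \<in> set ?all" "suffix_link w r = q" using S by (auto simp: children_def)
    then obtain i where i: "i < length ?all" "?all ! i = r" by (metis in_set_conv_nth)
    \<comment> \<open>In the whole order \<open>q\<close> has index \<open>length ps\<close>, and
      each child comes before it.\<close>
    have "i < length ps" using order[of i "length ps"] i r by simp
    then show "r \<in> set ps" using i by (auto simp: nth_append)
  qed
  then have "d ` children w q = state_distance w P ` children w q"
    using Cons.prems(2) by (intro image_cong) auto
  then have dq: "Min ({d q} \<union> d ` children w q) = state_distance w P q"
    using state_distance_rec[OF q P] Cons.prems(3)[of q] by simp
  \<comment> \<open>Distinctness keeps the update at \<open>q\<close> away from the pending
    states.\<close>
  have "traverse w qs (d(q := state_distance w P q)) \<longleftrightarrow>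
      (\<forall>q\<in>set qs. state_distance w P q < ereal (real (min_len q)))"
    using Cons.prems dist by (intro Cons.IH[of "ps @ [q]"]) auto
  then show ?case
    unfolding traverse.simps dq by (auto simp: Let_def not_le)
qed

section \<open>From distances to attractors\<close>

text \<open>An occurrence of \<open>u\<close> ending at \<open>j\<close> starts at
  \<open>j + 1 - |u|\<close>, so it contains \<open>t\<close> iff
  \<open>t \<le> j < t + |u|\<close>.\<close>

lemma covers_iff:
  assumes "u \<noteq> []"
  shows "covers w P u \<longleftrightarrow> (\<exists>j\<in>end_positions w u. distance P j < ereal (real (length u)))"
proof -
  have occ: "i + length u = Suc j" if "occurrence w u i j" for i j
    using that by (auto simp: occurrence_def slice_def)
  have "covers w P u \<longleftrightarrow> (\<exists>j\<in>end_positions w u. \<exists>t\<in>P. t \<le> j \<and> j < t + length u)"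
    using assms occ unfolding covers_def end_positions_def by fastforce
  then show ?thesis by (simp add: distance_less_iff)
qed

text \<open>The words of a state share their ending positions and hence the infimum, so the shortest
  one gives the tightest bound.\<close>

lemma word_attractor_iff:
  "word_attractor w P \<longleftrightarrow>
    (\<forall>q\<in>states w - {initial_state w}. state_distance w P q < ereal (real (min_len q)))"
proof
  assume att: "word_attractor w P"
  show "\<forall>q\<in>states w - {initial_state w}. state_distance w P q < ereal (real (min_len q))"
  proof
    fix q assume q: "q \<in> states w - {initial_state w}"
    note ne = non_initial_state[OF q]
    have "finite q"
      using q finite_factors[of w] state_eq(1)[of q w] by (meson DiffD1 finite_subset subsetI)
    \<comment> \<open>The state is finite and non-empty, so the minimum is attained by a word, whose
      covering gives the bound.\<close>
    then have "min_len q \<in> length ` q" unfolding min_len_def using ne by (intro Min_in) auto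
    then obtain u where u: "u \<in> q" "length u = min_len q" by auto
    then have "u \<noteq> []" "u \<in> factors w" using ne q state_eq(1) by auto
    with att have "\<exists>j\<in>end_positions w u. distance P j < ereal (real (length u))"
      using covers_iff[of u w P] by (auto simp: word_attractor_def)
    then show "state_distance w P q < ereal (real (min_len q))"
      using state_ends_eq[of q w u] q u by (simp add: state_distance_def INF_less_iff)
  qed
next
  assume small: "\<forall>q\<in>states w - {initial_state w}. state_distance w P q < ereal (real (min_len q))"
  show "word_attractor w P"
    unfolding word_attractor_def
  proof (intro ballI impI)
    fix u assume u: "u \<in> factors w" "u \<noteq> []"
    let ?q = "state_of w u"
    have "finite ?q"
      by (rule finite_subset[OF _ finite_factors[of w]]) (auto simp: state_of_def end_equiv_def)
    then have "min_len ?q \<le> length u"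
      unfolding min_len_def using in_state_of[OF u(1)] by simp
    then have "state_distance w P ?q < ereal (real (length u))"
      using small state_of_noninitial[OF u] by (meson ereal_less_eq(3) less_le_trans of_nat_mono)
    then show "covers w P u"
      using u by (simp add: covers_iff state_distance_def INF_less_iff state_ends_state_of)
  qed
qed

theorem proposition3:
  fixes \<Sigma> :: "'a set" and w :: "'a list" and P :: "nat set" and qs :: "'a list set list"
  assumes "finite \<Sigma>" and "w \<in> lists \<Sigma>"
    and "P \<subseteq> {1..length w}"
    and "bottom_up_traversal w qs"
  shows "word_attractor w P \<longleftrightarrow> is_attractor_alg w P qs"
proof -
  have "0 \<notin> P" using assms(3) by auto
  \<comment> \<open>The invariant starts with no visited state and with \<open>d\<close> as the
    position loop leaves it.\<close>
  then have "is_attractor_alg w P qs \<longleftrightarrow>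
      (\<forall>q\<in>set qs. state_distance w P q < ereal (real (min_len q)))"
    unfolding is_attractor_alg_def using assms(4) by (intro traverse_iff[of P w "[]"]) auto
  moreover have "set qs = states w - {initial_state w}"
    using assms(4) by (simp add: bottom_up_traversal_def)
  ultimately show ?thesis by (simp add: word_attractor_iff)
qed

end
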